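(* Let $n\ge 3$, $K<0$, and let $M\subset\mathbb{R}^n$ be the rotational hypersurface generated by the solution $\varphi$ of $$K\varphi^{n-2}=-\varphi''(1-\varphi'^2)^{\frac{n-3}{2}}$$ with integration constant $C_K=-1$, oriented so that $\varphi'>0$ and defined on $(-\infty,t_0]$, where $t_0$ is the point at which $\varphi$ reaches its maximum. Then the surface area of $M$ is finite. Moreover, the volume of the region enclosed by $M$ and the horizontal disk at the end of $M$ is also finite.
   Context: A rotational hypersurface in $\mathbb{R}^n$ is obtained by rotating around the $x_n$-axis a generating curve $(x_1,x_n)=(\varphi(t),\psi(t))$ with $\varphi>0$, parametrized by arclength ($\varphi'^2+\psi'^2=1$), with $\psi'\ge 0$; $\varphi$ is the radius and $\psi$ the height. The ODE says that $M$ has constant Gauss-Kronecker curvature $K$. The integration constant $C_K$ is defined by $K\varphi^{n-1}=(1-\varphi'^2)^{\frac{n-1}{2}}+C_K$. For $C_K=-1$ the solution with $\varphi'>0$ is defined on an interval $(-\infty,t_0]$, with $\varphi(t_0)=(-1/K)^{1/(n-1)}$ its maximum. "Surface area" is the $(n-1)$-dimensional volume of $M$, and "volume of the enclosed region" is the $n$-dimensional volume. The horizontal disk at the end of $M$ is the $(n-1)$-dimensional ball of radius $\varphi(t_0)$ in the hyperplane $x_n=\psi(t_0)$, centered on the $x_n$-axis. *)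

theory Defs
  imports "HOL-Analysis.Analysis"
begin

(* The d-dimensional Hausdorff (outer) measure, normalised so that it agrees with Lebesgue
   measure on d-dimensional Euclidean space. Empty covering sets are given weight 0 separately
   because 0 ^ 0 = 1. Boundedness is required because diameter is unspecified on unbounded sets. *)

definition hausdorff_weight :: "nat \<Rightarrow> 'a::metric_space set \<Rightarrow> ennreal" where
  "hausdorff_weight d U =
     (if U = {} then 0 else ennreal (unit_ball_vol (real d) * (diameter U / 2) ^ d))"

definition hausdorff_content :: "nat \<Rightarrow> real \<Rightarrow> 'a::metric_space set \<Rightarrow> ennreal" where
  "hausdorff_content d \<delta> A =
     (INF U \<in> {U :: nat \<Rightarrow> 'a set. A \<subseteq> (\<Union>i. U i) \<and> (\<forall>i. bounded (U i) \<and> diameter (U i) \<le> \<delta>)}.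
        \<Sum>i. hausdorff_weight d (U i))"

definition hausdorff_measure :: "nat \<Rightarrow> 'a::metric_space set \<Rightarrow> ennreal" where
  "hausdorff_measure d A = (SUP \<delta> \<in> {0<..}. hausdorff_content d \<delta> A)"

(* The index k is that of the coordinate axis of rotation, the x_n-axis in the usual notation. *)

definition axis_dist :: "'n::finite \<Rightarrow> real ^ 'n \<Rightarrow> real" where
  "axis_dist k x = norm (x - axis k (x $ k))"

definition rotational_hypersurface ::
    "'n::finite \<Rightarrow> (real \<Rightarrow> real) \<Rightarrow> (real \<Rightarrow> real) \<Rightarrow> real set \<Rightarrow> (real ^ 'n) set" where
  "rotational_hypersurface k \<phi> \<psi> I = {x. \<exists>t\<in>I. axis_dist k x = \<phi> t \<and> x $ k = \<psi> t}"

definition horizontal_disk :: "'n::finite \<Rightarrow> real \<Rightarrow> real \<Rightarrow> (real ^ 'n) set" where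
  "horizontal_disk k r h = {x. axis_dist k x \<le> r \<and> x $ k = h}"

(* A variant of inside for hypersurfaces with an infinitely long cusp along the axis, whose
   interior is unbounded: a point is enclosed by S if its component of the complement of S
   stays within a bounded distance of the axis. *)

definition enclosed_region :: "'n::finite \<Rightarrow> (real ^ 'n) set \<Rightarrow> (real ^ 'n) set" where
  "enclosed_region k S =
     {x. x \<notin> S \<and> bounded (axis_dist k ` connected_component_set (- S) x)}"

end

theory Submission
  imports Defs
begin

text \<open>
  Let \<open>u = \<phi>'\<^sup>2\<close>. The first integral reads \<open>-K \<phi> ^ (n-1) = 1 - (1 - u) powr ((n-1)/2)\<close>, so
  \<open>-K \<phi> ^ (n-1) \<le> (n-1) \<phi>'\<^sup>2\<close> by Bernoulli's inequality. Consequently the derivative of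
  \<open>\<phi> powr ((n-1)/2)\<close> dominates a multiple of \<open>\<phi> ^ (n-2)\<close>, and telescoping over unit intervals gives
  \<open>(\<Sum>j. \<phi> (t0 - j) ^ (n-2)) < \<infinity>\<close>. The piece of \<open>M\<close> over a unit interval on which \<open>\<phi> \<le> R\<close> has area
  \<open>O(R ^ (n-2))\<close>, uniformly in the scale of the coverings, and the enclosed region over it lies in a box of volume
  \<open>O(R ^ (n-1))\<close>; both sums converge. Since \<open>\<psi>\<close> is strictly increasing and unbounded below, \<open>M\<close> is
  closed, which makes the enclosed region open.
\<close>

subsection \<open>Hausdorff content of rotational hypersurfaces\<close>

lemma hausdorff_weight_le:
  assumes "bounded U" "diameter U \<le> r"
  shows "hausdorff_weight d U \<le> ennreal (unit_ball_vol (real d) * (r / 2) ^ d)"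
  using assms diameter_ge_0[of U]
  by (auto simp: hausdorff_weight_def intro!: ennreal_leI mult_left_mono power_mono)

text \<open>A cover has to be a single sequence, so the finite families are enumerated, padded with
  empty sets and merged by \<open>prod_decode\<close>. Padding is free because
  \<open>hausdorff_weight\<close> gives \<open>{}\<close> weight 0.\<close>

lemma hausdorff_content_le_suminf:
  fixes F :: "nat \<Rightarrow> 'a::metric_space set set"
  assumes "0 \<le> \<delta>"
    and cover: "A \<subseteq> (\<Union>j. \<Union>(F j))"
    and fin: "\<And>j. finite (F j)"
    and small: "\<And>j U. U \<in> F j \<Longrightarrow> bounded U \<and> diameter U \<le> \<delta>"
    and weight: "\<And>j. (\<Sum>U\<in>F j. hausdorff_weight d U) \<le> b j"
  shows "hausdorff_content d \<delta> A \<le> (\<Sum>j. b j)"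
proof -
  have "\<forall>j. \<exists>h. bij_betw h {..<card (F j)} (F j)"
    using ex_bij_betw_nat_finite[OF fin] by (simp add: atLeast0LessThan)
  then obtain h where h: "\<And>j. bij_betw (h j) {..<card (F j)} (F j)" by metis
  define V where "V = (\<lambda>(j, i). if i < card (F j) then h j i else {})"
  have V_cases: "V p = {} \<or> (\<exists>j. V p \<in> F j)" for p
    using bij_betwE[OF h] by (cases p) (auto simp: V_def)
  have "A \<subseteq> (\<Union>i. V (prod_decode i))"
  proof
    fix x assume "x \<in> A"
    then obtain j U where U: "U \<in> F j" "x \<in> U" using cover by blast
    then obtain i where "i < card (F j)" "U = h j i"
      using h[of j] by (auto simp: bij_betw_def)
    then have "x \<in> V (prod_decode (prod_encode (j, i)))" using U by (simp add: V_def)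
    then show "x \<in> (\<Union>i. V (prod_decode i))" by blast
  qed
  moreover have "bounded (V p) \<and> diameter (V p) \<le> \<delta>" for p
    using V_cases[of p]
  proof
    assume "V p = {}"
    then show ?thesis using \<open>0 \<le> \<delta>\<close> by (simp add: diameter_def)
  qed (use small in blast)
  ultimately have "hausdorff_content d \<delta> A \<le> (\<Sum>i. hausdorff_weight d (V (prod_decode i)))"
    unfolding hausdorff_content_def by (intro INF_lower) auto
  also have "\<dots> = (\<Sum>j. \<Sum>i. hausdorff_weight d (V (j, i)))"
    by (rule suminf_ennreal_2dimen[where f = "\<lambda>p. hausdorff_weight d (V p)"]) simp
  also have "\<dots> \<le> (\<Sum>j. b j)"
  proof (rule suminf_le)
    fix j
    have "(\<Sum>i. hausdorff_weight d (V (j, i))) = (\<Sum>i<card (F j). hausdorff_weight d (V (j, i)))"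
      by (rule suminf_finite) (auto simp: V_def hausdorff_weight_def)
    also have "\<dots> = (\<Sum>i<card (F j). hausdorff_weight d (h j i))"
      by (simp add: V_def)
    also have "\<dots> = (\<Sum>U\<in>F j. hausdorff_weight d U)"
      by (rule sum.reindex_bij_betw[OF h])
    finally show "(\<Sum>i. hausdorff_weight d (V (j, i))) \<le> b j" using weight[of j] by simp
  qed auto
  finally show ?thesis .
qed

lemma norm_axis: "norm (axis k c :: real ^ 'n) = \<bar>c\<bar>"
proof -
  have "axis k c = c *\<^sub>R (axis k 1 :: real ^ 'n)" by (simp add: vec_eq_iff axis_def)
  then show ?thesis by (metis norm_axis_1 norm_scaleR mult.right_neutral)
qed

section \<open>Diameter of a cell of the hypersurface\<close>

text \<open>Multiplied by \<open>norm v\<close>, the difference of the unit vectors becomes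
  \<open>v - w\<close> plus a vector of length at most \<open>norm (v - w)\<close>. Since
  \<open>norm v\<close> is at least 1, the factor 2 results.\<close>

lemma norm_normalize_diff_le:
  fixes v w :: "'a::real_normed_vector"
  assumes "1 \<le> norm v" "1 \<le> norm w"
  shows "norm (v /\<^sub>R norm v - w /\<^sub>R norm w) \<le> 2 * norm (v - w)"
proof -
  have "norm v *\<^sub>R (x - y) = (norm v *\<^sub>R x - norm w *\<^sub>R y) + (norm w - norm v) *\<^sub>R y" for x y :: 'a
    by (simp add: algebra_simps)
  moreover have nz: "v \<noteq> 0" "w \<noteq> 0" using assms by auto
  then have "norm v *\<^sub>R (v /\<^sub>R norm v) = v" "norm w *\<^sub>R (w /\<^sub>R norm w) = w" by simp_all
  ultimately have "norm v *\<^sub>R (v /\<^sub>R norm v - w /\<^sub>R norm w) = (v - w) + (norm w - norm v) *\<^sub>R (w /\<^sub>R norm w)"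
    by metis
  then have "norm v * norm (v /\<^sub>R norm v - w /\<^sub>R norm w)
      = norm ((v - w) + (norm w - norm v) *\<^sub>R (w /\<^sub>R norm w))"
    by (metis abs_norm_cancel norm_scaleR)
  also have "\<dots> \<le> norm (v - w) + \<bar>norm w - norm v\<bar> * norm (w /\<^sub>R norm w)"
    by (metis norm_triangle_ineq norm_scaleR)
  also have "norm (w /\<^sub>R norm w) = 1" using nz by simp
  also have "norm (v - w) + \<bar>norm w - norm v\<bar> * 1 \<le> 2 * norm (v - w)"
    using norm_triangle_ineq3[of v w] by simp
  finally have *: "norm v * norm (v /\<^sub>R norm v - w /\<^sub>R norm w) \<le> 2 * norm (v - w)" .
  have "1 * norm (v /\<^sub>R norm v - w /\<^sub>R norm w) \<le> norm v * norm (v /\<^sub>R norm v - w /\<^sub>R norm w)"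
    by (rule mult_right_mono) (use assms in auto)
  with * show ?thesis by linarith
qed

lemma grid_cell_exists:
  fixes v L :: real
  assumes "a \<le> v" "v \<le> a + L" "0 < L" "0 < N"
  obtains m :: nat where "m < N" "v \<in> {a + L * m / N .. a + L * (m + 1) / N}"
proof (cases "v = a + L")
  case True
  \<comment> \<open>The right endpoint goes to the last cell; rounding down would give the index
    \<open>N\<close>, which is out of range.\<close>
  show ?thesis by (rule that[of "N - 1"]) (use True assms in \<open>auto simp: field_simps of_nat_diff\<close>)
next
  case False
  define y where "y = (v - a) * N / L"
  have y: "0 \<le> y" "y < N" using assms False by (auto simp: y_def divide_simps)
  have v: "v = a + L * y / N" using assms by (simp add: y_def)
  have m: "real (nat \<lfloor>y\<rfloor>) \<le> y" "y \<le> real (nat \<lfloor>y\<rfloor>) + 1" "nat \<lfloor>y\<rfloor> < N"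
    using y by linarith+
  have "L * nat \<lfloor>y\<rfloor> / N \<le> L * y / N" "L * y / N \<le> L * (nat \<lfloor>y\<rfloor> + 1) / N"
    using m assms by (intro divide_right_mono mult_left_mono; linarith)+
  then show ?thesis using m(3) by (intro that[of "nat \<lfloor>y\<rfloor>"]) (auto simp: v)
qed

text \<open>Directions orthogonal to the axis are parametrized by central projection onto the surface of a
  cube: the coordinate \<open>i\<close> and the sign \<open>s\<close> select a face, and the sets \<open>J l\<close> a box in that face.\<close>

definition rotational_cell ::
    "'n::finite \<Rightarrow> (real \<Rightarrow> real) \<Rightarrow> (real \<Rightarrow> real) \<Rightarrow> real set \<Rightarrow> 'n \<Rightarrow> real \<Rightarrow> ('n \<Rightarrow> real set) \<Rightarrow> (real ^ 'n) set"
  where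
  "rotational_cell k \<phi> \<psi> T i s J =
     {x \<in> rotational_hypersurface k \<phi> \<psi> T. 0 < s * x $ i \<and> (\<forall>l. l \<noteq> k \<longrightarrow> l \<noteq> i \<longrightarrow> x $ l / (s * x $ i) \<in> J l)}"

text \<open>A point is given by height, radius and unit direction. Height and radius contribute
  \<open>h\<close> each. The direction is a normalised point of the cube surface whose coordinates
  vary by at most \<open>\<epsilon>\<close>; summing coordinates and applying
  \<open>norm_normalize_diff_le\<close> gives the last term.\<close>

lemma rotational_cell_dist:
  fixes k :: "'n::finite"
  assumes x: "x \<in> rotational_cell k \<phi> \<psi> T i s J" and y: "y \<in> rotational_cell k \<phi> \<psi> T i s J"
    and "i \<noteq> k" and s: "\<bar>s\<bar> = 1"
    and \<phi>: "\<And>t t'. t \<in> T \<Longrightarrow> t' \<in> T \<Longrightarrow> \<bar>\<phi> t - \<phi> t'\<bar> \<le> h"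
    and \<psi>: "\<And>t t'. t \<in> T \<Longrightarrow> t' \<in> T \<Longrightarrow> \<bar>\<psi> t - \<psi> t'\<bar> \<le> h"
    and R: "\<And>t. t \<in> T \<Longrightarrow> \<phi> t \<le> R"
    and J: "\<And>l u v. u \<in> J l \<Longrightarrow> v \<in> J l \<Longrightarrow> \<bar>u - v\<bar> \<le> \<epsilon>"
    and "0 \<le> \<epsilon>"
  shows "norm (x - y) \<le> 2 * h + 2 * R * CARD('n) * \<epsilon>"
proof -
  define u where "u = (\<lambda>z::real^'n. z - axis k (z $ k))"
  \<comment> \<open>For \<open>z\<close> in the cell, this scaling moves the part orthogonal to the
    axis onto the cube face where coordinate \<open>i\<close> equals \<open>s\<close>. Its norm is
    then at least 1, as \<open>norm_normalize_diff_le\<close> requires.\<close>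
  define w where "w = (\<lambda>z. u z /\<^sub>R (s * z $ i))"
  have norm_u: "norm (u z) = axis_dist k z" for z by (simp add: u_def axis_dist_def)
  have wl: "w z $ l = (if l = k then 0 else z $ l / (s * z $ i))" for z l
    by (simp add: w_def u_def axis_def divide_inverse mult.commute)
  have u: "u z = norm (u z) *\<^sub>R (w z /\<^sub>R norm (w z))" "1 \<le> norm (w z)"
    if "z \<in> rotational_cell k \<phi> \<psi> T i s J" for z
  proof -
    have pos: "0 < s * z $ i" using that by (simp add: rotational_cell_def)
    have "\<bar>w z $ i\<bar> = 1" using pos s \<open>i \<noteq> k\<close> by (auto simp: wl abs_mult)
    then show "1 \<le> norm (w z)" using component_le_norm_cart[of "w z" i] by simp
    have uw: "u z = (s * z $ i) *\<^sub>R w z" using pos unfolding w_def scaleR_scaleR by (subst right_inverse) auto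
    then have "norm (u z) = (s * z $ i) * norm (w z)" using pos by simp
    then show "u z = norm (u z) *\<^sub>R (w z /\<^sub>R norm (w z))" using \<open>1 \<le> norm (w z)\<close> uw
      by (metis abs_norm_cancel divide_inverse nonzero_mult_div_cancel_right norm_eq_zero norm_zero
          not_one_le_zero scaleR_scaleR mult.assoc)
  qed
  obtain t where t: "t \<in> T" "axis_dist k x = \<phi> t" "x $ k = \<psi> t"
    using x by (auto simp: rotational_cell_def rotational_hypersurface_def)
  obtain t' where t': "t' \<in> T" "axis_dist k y = \<phi> t'" "y $ k = \<psi> t'"
    using y by (auto simp: rotational_cell_def rotational_hypersurface_def)
  have "norm (w x - w y) \<le> (\<Sum>l\<in>UNIV. \<bar>(w x - w y) $ l\<bar>)" by (rule norm_le_l1_cart)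
  also have "\<dots> \<le> (\<Sum>l\<in>(UNIV::'n set). \<epsilon>)"
  proof (rule sum_mono)
    fix l
    show "\<bar>(w x - w y) $ l\<bar> \<le> \<epsilon>"
    proof (cases "l = k \<or> l = i")
      case True
      have "0 < s * x $ i" "0 < s * y $ i" using x y by (auto simp: rotational_cell_def)
      then show ?thesis using True \<open>0 \<le> \<epsilon>\<close> s by (auto simp: wl)
    next
      case False
      then show ?thesis using x y by (auto simp: wl rotational_cell_def intro!: J)
    qed
  qed
  finally have w: "norm (w x - w y) \<le> CARD('n) * \<epsilon>" by simp
  let ?v = "w x /\<^sub>R norm (w x)" and ?v' = "w y /\<^sub>R norm (w y)"
  have \<phi>_nonneg: "0 \<le> \<phi> t'" using t' norm_u[of y] by (metis norm_ge_zero)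
  have "u x - u y = (\<phi> t - \<phi> t') *\<^sub>R ?v + \<phi> t' *\<^sub>R (?v - ?v')"
  proof -
    have "a *\<^sub>R v - b *\<^sub>R v' = (a - b) *\<^sub>R v + b *\<^sub>R (v - v')" for a b and v v' :: "real ^ 'n"
      by (simp add: algebra_simps)
    then show ?thesis using u(1)[OF x] u(1)[OF y] unfolding norm_u t t' by metis
  qed
  then have "norm (u x - u y) \<le> \<bar>\<phi> t - \<phi> t'\<bar> * norm ?v + \<phi> t' * norm (?v - ?v')"
    using \<phi>_nonneg by (metis abs_of_nonneg norm_scaleR norm_triangle_ineq)
  also have "norm ?v = 1"
  proof -
    have "w x \<noteq> 0" using u(2)[OF x] by auto
    then show ?thesis by simp
  qed
  also have "\<bar>\<phi> t - \<phi> t'\<bar> * 1 \<le> h" using \<phi> t t' by simp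
  also have "\<phi> t' * norm (?v - ?v') \<le> R * (2 * (CARD('n) * \<epsilon>))"
    using R[OF t'(1)] \<phi>_nonneg norm_normalize_diff_le[OF u(2)[OF x] u(2)[OF y]] w
    by (intro mult_mono) auto
  finally have 1: "norm (u x - u y) \<le> h + R * (2 * (CARD('n) * \<epsilon>))" by simp
  have "x - y = (u x - u y) + axis k (x $ k - y $ k)"
    by (simp add: u_def vec_eq_iff axis_def)
  then have "norm (x - y) \<le> norm (u x - u y) + \<bar>x $ k - y $ k\<bar>"
    by (metis norm_triangle_ineq norm_axis)
  also have "\<bar>x $ k - y $ k\<bar> \<le> h" using \<psi> t t' by simp
  finally show ?thesis using 1 by simp
qed

section \<open>Covering a unit slab by small cells\<close>

text \<open>The face is given by an off-axis coordinate of largest absolute value. Positive radius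
  makes it nonzero, so the ratios of the off-axis coordinates to it lie in \<open>{-1..1}\<close>
  and fall into the grid.\<close>

lemma rotational_slab_subset_cells:
  fixes k :: "'n::finite"
  assumes \<phi>: "\<And>t. t \<in> {a..a + 1} \<Longrightarrow> 0 < \<phi> t" and P: "0 < (P::nat)" and N: "0 < (N::nat)"
    and x: "x \<in> rotational_hypersurface k \<phi> \<psi> {a..a + 1}"
  shows "\<exists>i\<in>- {k}. \<exists>p<P. \<exists>s\<in>{-1, 1}. \<exists>m\<in>(- {k, i}) \<rightarrow>\<^sub>E {..<N}.
     x \<in> rotational_cell k \<phi> \<psi> {a + 1 * real p / P .. a + 1 * real (p + 1) / P} i s
           (\<lambda>l. {-1 + 2 * real (m l) / N .. -1 + 2 * real (m l + 1) / N})"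
proof -
  obtain t where t: "t \<in> {a..a + 1}" "axis_dist k x = \<phi> t" "x $ k = \<psi> t"
    using x by (auto simp: rotational_hypersurface_def)
  obtain p where p: "p < P" "t \<in> {a + 1 * real p / P .. a + 1 * real (p + 1) / P}"
    using grid_cell_exists[of a t 1 P] t P by auto
  have "x - axis k (x $ k) \<noteq> 0" using t \<phi>[of t] by (auto simp: axis_dist_def)
  then obtain l where "(x - axis k (x $ k)) $ l \<noteq> 0" by (metis vec_eq_iff zero_index)
  then have l: "l \<noteq> k" "x $ l \<noteq> 0" by (auto simp: axis_def split: if_splits)
  have "finite (- {k})" "- {k} \<noteq> {}" using l by auto
  then obtain i where i: "i \<in> - {k}" and max: "\<And>j. j \<in> - {k} \<Longrightarrow> \<bar>x $ j\<bar> \<le> \<bar>x $ i\<bar>"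
    using obtains_MAX[of "- {k}" "\<lambda>j. \<bar>x $ j\<bar>"] Max_ge[of "(\<lambda>j. \<bar>x $ j\<bar>) ` (- {k})"]
    by (metis (no_types, lifting) finite_imageI imageI)
  have "x $ i \<noteq> 0" using max[of l] l by auto
  define s where "s = sgn (x $ i)"
  have s: "s \<in> {-1, 1}" "s * x $ i = \<bar>x $ i\<bar>" "0 < s * x $ i"
    using \<open>x $ i \<noteq> 0\<close> by (auto simp: s_def sgn_if)
  have "\<forall>j. \<exists>q<N. j \<noteq> k \<longrightarrow> x $ j / (s * x $ i) \<in> {-1 + 2 * real q / N .. -1 + 2 * real (q + 1) / N}"
  proof
    fix j
    show "\<exists>q<N. j \<noteq> k \<longrightarrow> x $ j / (s * x $ i) \<in> {-1 + 2 * real q / N .. -1 + 2 * real (q + 1) / N}"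
    proof (cases "j = k")
      case True
      then show ?thesis using N by blast
    next
      case False
      then have "\<bar>x $ j\<bar> \<le> s * x $ i" using max[of j] s by auto
      then have "- 1 \<le> x $ j / (s * x $ i)" "x $ j / (s * x $ i) \<le> 1"
        using s(3) by (auto simp: pos_le_divide_eq pos_divide_le_eq)
      then show ?thesis using grid_cell_exists[of "-1" "x $ j / (s * x $ i)" 2 N] N by auto
    qed
  qed
  then obtain q where q: "\<And>j. q j < N"
      "\<And>j. j \<noteq> k \<Longrightarrow> x $ j / (s * x $ i) \<in> {-1 + 2 * real (q j) / N .. -1 + 2 * real (q j + 1) / N}"
    by metis
  \<comment> \<open>Restricting to the coordinates that matter places the index in a finite
    \<open>PiE\<close> set, so that cells can be counted.\<close>
  have "restrict q (- {k, i}) \<in> (- {k, i}) \<rightarrow>\<^sub>E {..<N}" using q by auto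
  moreover have "x \<in> rotational_cell k \<phi> \<psi> {a + 1 * real p / P .. a + 1 * real (p + 1) / P} i s
           (\<lambda>l. {-1 + 2 * real (restrict q (- {k, i}) l) / N .. -1 + 2 * real (restrict q (- {k, i}) l + 1) / N})"
    unfolding rotational_cell_def rotational_hypersurface_def
    using p t s(3) q(2) by auto
  ultimately show ?thesis using i p(1) s(1) by blast
qed

text \<open>The number of cells times the weight of one, with powers of \<open>P\<close> and
  \<open>R\<close> removed: \<open>2 * n\<close> bounds the number of faces,
  \<open>2 ^ (n - 2)\<close> pays for rounding the grid size, and \<open>(1 + 2 * n) / P\<close> is
  half the diameter bound.\<close>

definition slab_const :: "nat \<Rightarrow> real" where
  "slab_const n = 2 * real n * 2 ^ (n - 2) * unit_ball_vol (real (n - 1)) * (1 + 2 * real n) ^ (n - 1)"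

text \<open>The weight bound is independent of \<open>\<delta>\<close>, so it survives the supremum
  over scales. The power of \<open>R\<close> reflects one direction of unit length along the curve
  and \<open>n - 2\<close> directions of size \<open>R\<close> around the axis.\<close>

lemma rotational_slab_cover:
  fixes k :: "'n::finite"
  assumes card: "2 \<le> CARD('n)" and "0 < \<delta>" and "0 < R"
    and \<phi>: "\<And>t. t \<in> {a..a + 1} \<Longrightarrow> 0 < \<phi> t" and R: "\<And>t. t \<in> {a..a + 1} \<Longrightarrow> \<phi> t \<le> R"
    and lip_\<phi>: "\<And>t t'. t \<in> {a..a + 1} \<Longrightarrow> t' \<in> {a..a + 1} \<Longrightarrow> \<bar>\<phi> t - \<phi> t'\<bar> \<le> \<bar>t - t'\<bar>"
    and lip_\<psi>: "\<And>t t'. t \<in> {a..a + 1} \<Longrightarrow> t' \<in> {a..a + 1} \<Longrightarrow> \<bar>\<psi> t - \<psi> t'\<bar> \<le> \<bar>t - t'\<bar>"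
  shows "\<exists>F. finite F \<and> rotational_hypersurface k \<phi> \<psi> {a..a + 1} \<subseteq> \<Union>F \<and>
     (\<forall>U\<in>F. bounded U \<and> diameter U \<le> \<delta>) \<and>
     (\<Sum>U\<in>F. hausdorff_weight (CARD('n) - 1) U) \<le> ennreal (slab_const CARD('n) * R ^ (CARD('n) - 2))"
proof -
  let ?n = "CARD('n)"
  \<comment> \<open>With time steps \<open>1 / P\<close> and about \<open>P * R\<close> grid points per edge of the cube, the cells have diameter
    \<open>O(1 / P)\<close> and there are \<open>O(P * (P * R) ^ (n - 2))\<close> of them, so \<open>P\<close> cancels in the total weight.\<close>
  define P where "P = Suc (nat \<lceil>max (1 / R) ((2 + 4 * real ?n) / \<delta>)\<rceil>)"
  have "max (1 / R) ((2 + 4 * real ?n) / \<delta>) \<le> real P"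
    unfolding P_def by linarith
  then have "1 / R \<le> P" "(2 + 4 * real ?n) / \<delta> \<le> P" by auto
  then have P: "0 < P" "1 \<le> P * R" "(2 + 4 * real ?n) / P \<le> \<delta>"
    using \<open>0 < R\<close> \<open>0 < \<delta>\<close> by (auto simp: P_def field_simps)
  \<comment> \<open>Because \<open>P * R\<close> is at least 1, rounding up at most doubles
    it.\<close>
  define N where "N = nat \<lceil>P * R\<rceil>"
  have N: "0 < N" "P * R \<le> N" "N \<le> 2 * P * R"
    using P(2) unfolding N_def by linarith+
  define U where "U = (\<lambda>i (p, s, m).
     rotational_cell k \<phi> \<psi> {a + 1 * real p / P .. a + 1 * real (p + 1) / P} i s
           (\<lambda>l. {-1 + 2 * real (m l) / N .. -1 + 2 * real (m l + 1) / N}))"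
  define I where "I = (\<lambda>i. {..<P} \<times> {-1, 1 :: real} \<times> ((- {k, i}) \<rightarrow>\<^sub>E {..<N}))"
  define F where "F = (\<Union>i\<in>- {k}. U i ` I i)"
  \<comment> \<open>This bounds the diameter of a cell: height and radius give \<open>2 / P\<close>,
    and the direction gives \<open>4 * n * R / N\<close>, where \<open>R / N\<close> is at most
    \<open>1 / P\<close>.\<close>
  define r where "r = (2 + 4 * real ?n) / P"
  have fin_I: "finite (I i)" for i unfolding I_def by (intro finite_cartesian_product finite_PiE) auto
  have fin: "finite F" unfolding F_def by (intro finite_UN_I finite_imageI fin_I) simp
  have card_I: "card (I i) = P * (2 * N ^ (?n - 2))" if "i \<in> - {k}" for i
  proof -
    have "card (- {k, i}) = ?n - 2" using that by (simp add: Compl_eq_Diff_UNIV card_Diff_subset)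
    then show ?thesis unfolding I_def by (simp add: card_cartesian_product card_PiE)
  qed
  have "card F \<le> (\<Sum>i\<in>- {k}. card (U i ` I i))" unfolding F_def by (rule card_UN_le) simp
  also have "\<dots> \<le> (\<Sum>i\<in>- {k}. P * (2 * N ^ (?n - 2)))"
    by (rule sum_mono) (metis card_I card_image_le fin_I)
  also have "\<dots> \<le> ?n * (P * (2 * N ^ (?n - 2)))" by (simp add: card_mono)
  finally have "real (card F) \<le> real (?n * (P * (2 * N ^ (?n - 2))))" by (simp only: of_nat_le_iff)
  also have "\<dots> \<le> ?n * (P * (2 * (2 * P * R) ^ (?n - 2)))"
    using N by (auto intro!: mult_left_mono power_mono)
  finally have card_F: "real (card F) \<le> ?n * (P * (2 * (2 * P * R) ^ (?n - 2)))" .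
  have cover: "rotational_hypersurface k \<phi> \<psi> {a..a + 1} \<subseteq> \<Union>F"
  proof
    fix x assume x: "x \<in> rotational_hypersurface k \<phi> \<psi> {a..a + 1}"
    from rotational_slab_subset_cells[OF \<phi> P(1) N(1) x]
    obtain i p s m where "i \<in> - {k}" "p < P" "s \<in> {-1, 1}" "m \<in> (- {k, i}) \<rightarrow>\<^sub>E {..<N}"
      and x: "x \<in> U i (p, s, m)"
      unfolding U_def prod.case by blast
    then have "U i (p, s, m) \<in> F" unfolding F_def I_def
      by (intro UN_I) (assumption, intro imageI SigmaI lessThan_iff[THEN iffD2])
    then show "x \<in> \<Union>F" using x by (rule UnionI)
  qed
  have small: "bounded V \<and> diameter V \<le> r" if V_F: "V \<in> F" for V
  proof -
    obtain i q where i: "i \<in> - {k}" and "q \<in> I i" "V = U i q"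
      using V_F unfolding F_def by blast
    then obtain p s m where I: "(p, s, m) \<in> I i" and V: "V = U i (p, s, m)" by (metis prod_cases3)
    have p: "p < P" and "s \<in> {-1, 1}" using I unfolding I_def by (simp_all only: mem_Sigma_iff lessThan_iff)
    then have s: "\<bar>s\<bar> = 1" by auto
    let ?T = "{a + 1 * real p / P .. a + 1 * real (p + 1) / P}"
    have "real (p + 1) / P \<le> 1" using p by simp
    then have T: "t \<in> {a..a + 1}" if "t \<in> ?T" for t
      using that by (simp, smt (verit) divide_nonneg_nonneg of_nat_0_le_iff)
    have T2: "\<bar>t - t'\<bar> \<le> 1 / P" if "t \<in> ?T" "t' \<in> ?T" for t t'
      using that by (auto simp: add_divide_distrib)
    have d: "norm (x - y) \<le> r" if "x \<in> V" "y \<in> V" for x y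
    proof -
      have "norm (x - y) \<le> 2 * (1 / P) + 2 * R * ?n * (2 / N)"
      proof (rule rotational_cell_dist[where h = "1 / P" and \<epsilon> = "2 / N"])
        show "x \<in> rotational_cell k \<phi> \<psi> ?T i s (\<lambda>l. {-1 + 2 * real (m l) / N .. -1 + 2 * real (m l + 1) / N})"
             "y \<in> rotational_cell k \<phi> \<psi> ?T i s (\<lambda>l. {-1 + 2 * real (m l) / N .. -1 + 2 * real (m l + 1) / N})"
          using that by (simp_all add: V U_def)
        show "\<bar>\<phi> t - \<phi> t'\<bar> \<le> 1 / P" "\<bar>\<psi> t - \<psi> t'\<bar> \<le> 1 / P" if "t \<in> ?T" "t' \<in> ?T" for t t'
          using lip_\<phi>[OF T T, OF that] lip_\<psi>[OF T T, OF that] T2[OF that] by linarith+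
        show "\<bar>u - v\<bar> \<le> 2 / N" if "u \<in> {-1 + 2 * real (m l) / N .. -1 + 2 * real (m l + 1) / N}"
          "v \<in> {-1 + 2 * real (m l) / N .. -1 + 2 * real (m l + 1) / N}" for l u v
          using that by (auto simp: add_divide_distrib)
      qed (use i s R T in auto)
      also have "2 * R * ?n * (2 / N) = 4 * ?n * (R / N)" by simp
      also have "R / N \<le> 1 / P" using N P(1) by (simp add: field_simps)
      finally show ?thesis by (simp add: r_def add_divide_distrib)
    qed
    have "bounded V" unfolding bounded_def by (metis d dist_norm)
    moreover have "diameter V \<le> r" by (rule diameter_le) (use d in \<open>auto simp: r_def\<close>)
    ultimately show ?thesis by simp
  qed
  let ?w = "unit_ball_vol (real (?n - 1)) * (r / 2) ^ (?n - 1)"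
  have "(\<Sum>V\<in>F. hausdorff_weight (?n - 1) V) \<le> of_nat (card F) * ennreal ?w"
    by (rule sum_bounded_above) (use small hausdorff_weight_le in blast)
  also have "\<dots> = ennreal (card F * ?w)"
    by (simp add: ennreal_mult r_def ennreal_of_nat_eq_real_of_nat)
  also have "\<dots> \<le> ennreal (?n * (P * (2 * (2 * P * R) ^ (?n - 2))) * ?w)"
    using card_F by (intro ennreal_leI mult_right_mono) (auto simp: r_def)
  also have "?n * (P * (2 * (2 * P * R) ^ (?n - 2))) * ?w = slab_const ?n * R ^ (?n - 2)"
  proof -
    \<comment> \<open>With this form of the exponents, the \<open>P * P ^ q\<close> from the count
      cancels the \<open>P ^ Suc q\<close> in the weight.\<close>
    obtain q where q: "?n - 1 = Suc q" "?n - 2 = q" using card by (metis Suc_diff_le Suc_1 diff_Suc_Suc numeral_2_eq_2)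
    have r2: "r / 2 = (1 + 2 * real ?n) / P" using P(1) by (simp add: r_def field_simps)
    show ?thesis using P(1) unfolding slab_const_def q r2
      by (simp add: power_mult_distrib power_divide)
  qed
  finally have "(\<Sum>V\<in>F. hausdorff_weight (?n - 1) V) \<le> ennreal (slab_const ?n * R ^ (?n - 2))" .
  moreover have "bounded V \<and> diameter V \<le> \<delta>" if "V \<in> F" for V
    using small[OF that] P(3) by (auto simp: r_def)
  ultimately show ?thesis using fin cover by blast
qed

lemma atMost_eq_UN_unit_intervals: "{..t0} = (\<Union>j. {t0 - real (Suc j)..t0 - real (Suc j) + 1})"
proof
  show "{..t0} \<subseteq> (\<Union>j. {t0 - real (Suc j)..t0 - real (Suc j) + 1})"
  proof
    fix t assume "t \<in> {..t0}"
    then have "t \<in> {t0 - real (Suc (nat \<lfloor>t0 - t\<rfloor>))..t0 - real (Suc (nat \<lfloor>t0 - t\<rfloor>)) + 1}"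
      by simp linarith
    then show "t \<in> (\<Union>j. {t0 - real (Suc j)..t0 - real (Suc j) + 1})" by blast
  qed
qed auto

text \<open>For each fixed \<open>\<delta>\<close>, the covers of the unit slabs are combined. The
  covers depend on \<open>\<delta>\<close>, but the bounding series does not.\<close>

lemma hausdorff_measure_rotational_hypersurface_finite:
  fixes k :: "'n::finite"
  assumes card: "2 \<le> CARD('n)"
    and pos: "\<And>t. t \<le> t0 \<Longrightarrow> 0 < \<phi> t"
    and mono: "\<And>s t. s \<le> t \<Longrightarrow> t \<le> t0 \<Longrightarrow> \<phi> s \<le> \<phi> t"
    and lip_\<phi>: "\<And>s t. s \<le> t0 \<Longrightarrow> t \<le> t0 \<Longrightarrow> \<bar>\<phi> s - \<phi> t\<bar> \<le> \<bar>s - t\<bar>"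
    and lip_\<psi>: "\<And>s t. s \<le> t0 \<Longrightarrow> t \<le> t0 \<Longrightarrow> \<bar>\<psi> s - \<psi> t\<bar> \<le> \<bar>s - t\<bar>"
    and sum: "summable (\<lambda>j. \<phi> (t0 - real j) ^ (CARD('n) - 2))"
  shows "hausdorff_measure (CARD('n) - 1) (rotational_hypersurface k \<phi> \<psi> {..t0}) < \<infinity>"
proof -
  let ?n = "CARD('n)"
  let ?S = "\<lambda>j. rotational_hypersurface k \<phi> \<psi> {t0 - real (Suc j)..t0 - real (Suc j) + 1}"
  \<comment> \<open>On slab \<open>j\<close> the increasing radius is largest at the right endpoint
    \<open>t0 - j\<close>.\<close>
  let ?c = "\<lambda>j. slab_const ?n * \<phi> (t0 - real j) ^ (?n - 2)"
  have "hausdorff_content (?n - 1) \<delta> (rotational_hypersurface k \<phi> \<psi> {..t0}) \<le> (\<Sum>j. ennreal (?c j))"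
    if "0 < \<delta>" for \<delta>
  proof -
    have "\<exists>F. finite F \<and> ?S j \<subseteq> \<Union>F \<and> (\<forall>U\<in>F. bounded U \<and> diameter U \<le> \<delta>) \<and>
      (\<Sum>U\<in>F. hausdorff_weight (?n - 1) U) \<le> ennreal (?c j)" for j
      by (rule rotational_slab_cover[OF card that]) (auto intro!: pos mono lip_\<phi> lip_\<psi>)
    then obtain F where F: "\<And>j. finite (F j)" "\<And>j. ?S j \<subseteq> \<Union>(F j)"
      "\<And>j U. U \<in> F j \<Longrightarrow> bounded U \<and> diameter U \<le> \<delta>"
      "\<And>j. (\<Sum>U\<in>F j. hausdorff_weight (?n - 1) U) \<le> ennreal (?c j)" by metis
    have "rotational_hypersurface k \<phi> \<psi> {..t0} = (\<Union>j. ?S j)"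
      unfolding rotational_hypersurface_def atMost_eq_UN_unit_intervals[of t0] by blast
    also have "\<dots> \<subseteq> (\<Union>j. \<Union>(F j))" using F(2) by blast
    finally have "rotational_hypersurface k \<phi> \<psi> {..t0} \<subseteq> (\<Union>j. \<Union>(F j))" .
    from hausdorff_content_le_suminf[OF less_imp_le[OF that] this F(1,3,4)] show ?thesis .
  qed
  then have "hausdorff_measure (?n - 1) (rotational_hypersurface k \<phi> \<psi> {..t0}) \<le> (\<Sum>j. ennreal (?c j))"
    unfolding hausdorff_measure_def by (intro SUP_least) auto
  also have "\<dots> = ennreal (\<Sum>j. ?c j)"
    using pos by (intro suminf_ennreal2 summable_mult sum)
      (auto simp: slab_const_def intro!: mult_nonneg_nonneg zero_le_power less_imp_le)
  finally show ?thesis by (simp add: le_less_trans)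
qed

subsection \<open>The enclosed region\<close>

definition rotational_tube ::
    "'n::finite \<Rightarrow> (real \<Rightarrow> real) \<Rightarrow> (real \<Rightarrow> real) \<Rightarrow> real set \<Rightarrow> (real ^ 'n) set" where
  "rotational_tube k \<phi> \<psi> I = {x. \<exists>t\<in>I. axis_dist k x \<le> \<phi> t \<and> x $ k = \<psi> t}"

lemma continuous_on_axis_dist:
  fixes k :: "'n::finite"
  shows "continuous_on A (axis_dist k)"
proof -
  have "continuous_on A (\<lambda>x::real^'n. x $ k *\<^sub>R (axis k 1 :: real^'n))" by (intro continuous_intros)
  moreover have "x $ k *\<^sub>R axis k 1 = axis k (x $ k)" for x :: "real^'n" by (simp add: vec_eq_iff axis_def)
  ultimately show ?thesis unfolding axis_dist_def by (intro continuous_intros) simp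
qed

lemma norm_component_le_axis_dist: "l \<noteq> k \<Longrightarrow> \<bar>x $ l\<bar> \<le> axis_dist k x"
  using component_le_norm_cart[of "x - axis k (x $ k)" l] by (simp add: axis_dist_def axis_def)

lemma axis_dist_stretch:
  fixes k :: "'n::finite" and x :: "real ^ 'n"
  defines "y \<equiv> \<lambda>c. axis k (x $ k) + c *\<^sub>R (x - axis k (x $ k))"
  shows "y c $ k = x $ k" "axis_dist k (y c) = \<bar>c\<bar> * axis_dist k x"
proof -
  show k: "y c $ k = x $ k" by (simp add: y_def axis_def)
  show "axis_dist k (y c) = \<bar>c\<bar> * axis_dist k x"
    unfolding axis_dist_def k by (simp add: y_def)
qed

text \<open>Over each unit interval the tube lies in a box of height at most 1, as
  \<open>\<psi>\<close> is 1-Lipschitz, with all other edges twice the largest radius. A measurable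
  superset suffices, so measurability of the tube is not at issue.\<close>

lemma rotational_tube_finite_volume:
  fixes k :: "'n::finite"
  assumes card: "2 \<le> CARD('n)"
    and pos: "\<And>t. t \<le> t0 \<Longrightarrow> 0 < \<phi> t"
    and mono: "\<And>s t. s \<le> t \<Longrightarrow> t \<le> t0 \<Longrightarrow> \<phi> s \<le> \<phi> t"
    and mono_\<psi>: "\<And>s t. s \<le> t \<Longrightarrow> t \<le> t0 \<Longrightarrow> \<psi> s \<le> \<psi> t"
    and lip_\<psi>: "\<And>s t. s \<le> t0 \<Longrightarrow> t \<le> t0 \<Longrightarrow> \<bar>\<psi> s - \<psi> t\<bar> \<le> \<bar>s - t\<bar>"
    and sum: "summable (\<lambda>j. \<phi> (t0 - real j) ^ (CARD('n) - 2))"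
  shows "\<exists>B\<in>sets lborel. rotational_tube k \<phi> \<psi> {..t0} \<subseteq> B \<and> emeasure lborel B < \<infinity>"
proof -
  let ?n = "CARD('n)"
  define lo where "lo = (\<lambda>j. \<chi> l. if l = k then \<psi> (t0 - real (Suc j)) else - \<phi> (t0 - real j))"
  define hi where "hi = (\<lambda>j. \<chi> l. if l = k then \<psi> (t0 - real j) else \<phi> (t0 - real j))"
  define B where "B = (\<Union>j. cbox (lo j) (hi j) :: (real^'n) set)"
  \<comment> \<open>One of the \<open>n - 1\<close> radius factors is bounded by
    \<open>\<phi> t0\<close>, so the series from the area estimate also controls the volume.\<close>
  let ?c = "\<lambda>j. 2 ^ (?n - 1) * \<phi> t0 * \<phi> (t0 - real j) ^ (?n - 2)"
  have "rotational_tube k \<phi> \<psi> {..t0} \<subseteq> B"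
  proof
    fix x assume "x \<in> rotational_tube k \<phi> \<psi> {..t0}"
    then obtain t where t: "t \<in> {..t0}" "axis_dist k x \<le> \<phi> t" "x $ k = \<psi> t"
      by (auto simp: rotational_tube_def)
    then obtain j where j: "t0 - real (Suc j) \<le> t" "t \<le> t0 - real j"
      using atMost_eq_UN_unit_intervals[of t0] by auto
    have "\<phi> t \<le> \<phi> (t0 - real j)" using j by (intro mono) auto
    then have "\<bar>x $ l\<bar> \<le> \<phi> (t0 - real j)" if "l \<noteq> k" for l
      using norm_component_le_axis_dist[OF that, of x] t(2) by linarith
    then have "x \<in> cbox (lo j) (hi j)"
      using j t by (auto simp: mem_box_cart lo_def hi_def abs_le_iff minus_le_iff intro!: mono_\<psi>)
    then show "x \<in> B" unfolding B_def by blast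
  qed
  moreover have "emeasure lborel (cbox (lo j) (hi j)) \<le> ennreal (?c j)" for j
  proof -
    let ?r = "\<phi> (t0 - real j)"
    have r: "0 < ?r" "?r \<le> \<phi> t0" using pos mono by auto
    have k: "\<psi> (t0 - real (Suc j)) \<le> \<psi> (t0 - real j)" by (rule mono_\<psi>) auto
    have "cbox (lo j) (hi j) \<noteq> {}" using r k by (auto simp: interval_ne_empty_cart lo_def hi_def)
    then have "measure lborel (cbox (lo j) (hi j)) = (\<Prod>l\<in>UNIV. hi j $ l - lo j $ l)"
      by (rule content_cbox_cart)
    also have "\<dots> = (hi j $ k - lo j $ k) * (\<Prod>l\<in>UNIV - {k}. hi j $ l - lo j $ l)"
      by (rule prod.remove) auto
    also have "(\<Prod>l\<in>UNIV - {k}. hi j $ l - lo j $ l) = (\<Prod>l\<in>UNIV - {k}. 2 * ?r)"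
      by (rule prod.cong) (auto simp: hi_def lo_def)
    also have "\<dots> = (2 * ?r) ^ (?n - 1)" by (simp add: card_Diff_subset)
    also have "(hi j $ k - lo j $ k) * (2 * ?r) ^ (?n - 1) \<le> 1 * (2 * ?r) ^ (?n - 1)"
      using lip_\<psi>[of "t0 - real j" "t0 - real (Suc j)"] r
      by (intro mult_right_mono) (auto simp: hi_def lo_def)
    also have "1 * (2 * ?r) ^ (?n - 1) = 2 ^ (?n - 1) * ?r * ?r ^ (?n - 2)"
    proof -
      obtain q where "?n - 1 = Suc q" "?n - 2 = q" using card by (metis Suc_diff_le Suc_1 diff_Suc_Suc numeral_2_eq_2)
      then show ?thesis by (simp add: power_mult_distrib)
    qed
    also have "\<dots> \<le> ?c j" using r by (intro mult_right_mono mult_left_mono) auto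
    finally have "ennreal (measure lborel (cbox (lo j) (hi j))) \<le> ennreal (?c j)" by (rule ennreal_leI)
    then show ?thesis by (subst emeasure_eq_ennreal_measure) (use emeasure_lborel_cbox_finite[of "lo j" "hi j"] in auto)
  qed
  then have "emeasure lborel B \<le> (\<Sum>j. ennreal (?c j))"
    unfolding B_def
    by (intro order.trans[OF emeasure_subadditive_countably] suminf_le) auto
  moreover have "(\<Sum>j. ennreal (?c j)) = ennreal (\<Sum>j. ?c j)"
    using pos by (intro suminf_ennreal2 summable_mult sum)
      (auto intro!: mult_nonneg_nonneg zero_le_power less_imp_le)
  ultimately show ?thesis by (intro bexI[of _ B]) (auto simp: B_def le_less_trans)
qed

section \<open>Topology of the enclosed region\<close>

text \<open>A convergent sequence has bounded heights. As \<open>\<psi>\<close> is monotone and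
  unbounded below, its parameters stay in a compact interval, and a convergent subsequence of them
  gives the limit point.\<close>

lemma closed_rotational_hypersurface:
  fixes k :: "'n::finite"
  assumes cont: "continuous_on {..t0} \<phi>" "continuous_on {..t0} \<psi>"
    and mono_\<psi>: "\<And>s t. s \<le> t \<Longrightarrow> t \<le> t0 \<Longrightarrow> \<psi> s \<le> \<psi> t"
    and unbounded: "\<And>c. \<exists>t\<le>t0. \<psi> t < c"
  shows "closed (rotational_hypersurface k \<phi> \<psi> {..t0})"
  unfolding closed_sequential_limits
proof (intro allI impI, elim conjE)
  fix x l assume x: "\<forall>n. x n \<in> rotational_hypersurface k \<phi> \<psi> {..t0}" and lim: "x \<longlonglongrightarrow> l"
  then have "\<forall>n. \<exists>t. t \<le> t0 \<and> axis_dist k (x n) = \<phi> t \<and> x n $ k = \<psi> t"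
    by (auto simp: rotational_hypersurface_def)
  then obtain t where t: "\<And>n. t n \<le> t0" "\<And>n. axis_dist k (x n) = \<phi> (t n)" "\<And>n. x n $ k = \<psi> (t n)"
    by metis
  have "bounded (range x)" using lim by (intro convergent_imp_bounded)
  then obtain b where b: "\<And>n. norm (x n) \<le> b" unfolding bounded_iff by auto
  obtain a where a: "a \<le> t0" "\<psi> a < - b" using unbounded by blast
  have "t n \<in> {a..t0}" for n
  proof (rule ccontr)
    assume "t n \<notin> {a..t0}"
    then have "\<psi> (t n) \<le> \<psi> a" using t(1)[of n] a by (intro mono_\<psi>) auto
    then show False using a b[of n] component_le_norm_cart[of "x n" k] t(3)[of n] by linarith
  qed
  then obtain s r where s: "s \<in> {a..t0}" "strict_mono r" "(t \<circ> r) \<longlonglongrightarrow> s"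
    using compact_Icc[of a t0] unfolding compact_def by metis
  have *: "(\<lambda>n. f (t (r n))) \<longlonglongrightarrow> f s" if "continuous_on {..t0} f" for f :: "real \<Rightarrow> real"
    by (rule continuous_on_tendsto_compose[OF that]) (use s t in \<open>auto simp: o_def\<close>)
  have lim_r: "(\<lambda>n. x (r n)) \<longlonglongrightarrow> l" using LIMSEQ_subseq_LIMSEQ[OF lim s(2)] by (simp add: o_def)
  have "(\<lambda>n. axis_dist k (x (r n))) \<longlonglongrightarrow> axis_dist k l"
    by (rule continuous_on_tendsto_compose[OF continuous_on_axis_dist[of UNIV] lim_r]) auto
  then have "axis_dist k l = \<phi> s" using *[OF cont(1)] unfolding t(2) by (rule LIMSEQ_unique)
  moreover have "(\<lambda>n. x (r n) $ k) \<longlonglongrightarrow> l $ k" by (intro tendsto_intros lim_r)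
  then have "l $ k = \<psi> s" using *[OF cont(2)] unfolding t(3) by (rule LIMSEQ_unique)
  ultimately show "l \<in> rotational_hypersurface k \<phi> \<psi> {..t0}"
    using s by (auto simp: rotational_hypersurface_def)
qed

lemma closed_horizontal_disk: "closed (horizontal_disk k r h)"
  unfolding horizontal_disk_def
  by (intro closed_Collect_conj closed_Collect_le closed_Collect_eq continuous_on_axis_dist continuous_intros)

text \<open>Membership depends only on the component of the complement, and components of an open
  set are open here. Openness later supplies measurability.\<close>

lemma open_enclosed_region:
  assumes "closed S"
  shows "open (enclosed_region k S)"
proof (rule openI)
  fix x assume x: "x \<in> enclosed_region k S"
  let ?C = "connected_component_set (- S) x"
  have "open ?C" using assms by (simp add: open_connected_component open_Compl)
  moreover have "x \<in> ?C" using x by (simp add: enclosed_region_def)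
  moreover have "?C \<subseteq> enclosed_region k S"
  proof
    fix y assume y: "y \<in> ?C"
    then have "connected_component_set (- S) y = ?C" by (metis connected_component_eq)
    moreover have "y \<notin> S" using y connected_component_subset by fastforce
    ultimately show "y \<in> enclosed_region k S" using x by (simp add: enclosed_region_def)
  qed
  ultimately show "\<exists>e>0. ball x e \<subseteq> enclosed_region k S"
    by (meson open_contains_ball order.trans)
qed

text \<open>The ray from \<open>x\<close> orthogonally away from the axis stays in the component of \<open>x\<close>.\<close>

lemma not_enclosed_if_ray:
  fixes k :: "'n::finite"
  assumes "0 < axis_dist k x"
    and ray: "\<And>y. y $ k = x $ k \<Longrightarrow> axis_dist k x \<le> axis_dist k y \<Longrightarrow> y \<notin> S"
  shows "x \<notin> enclosed_region k S"
proof
  assume "x \<in> enclosed_region k S"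
  then obtain b where b: "\<And>y. y \<in> connected_component_set (- S) x \<Longrightarrow> axis_dist k y \<le> b"
    unfolding enclosed_region_def bounded_iff by (auto simp: axis_dist_def)
  define f where "f = (\<lambda>c. axis k (x $ k) + c *\<^sub>R (x - axis k (x $ k)))"
  have f: "f c $ k = x $ k" "axis_dist k (f c) = \<bar>c\<bar> * axis_dist k x" for c
    unfolding f_def by (rule axis_dist_stretch)+
  have "connected (f ` {1..})"
    unfolding f_def by (intro connected_continuous_image continuous_intros) auto
  moreover have "x \<in> f ` {1..}" by (rule image_eqI[of _ _ 1]) (auto simp: f_def)
  moreover have "f ` {1..} \<subseteq> - S"
  proof (clarify)
    fix c :: real assume "1 \<le> c" "f c \<in> S"
    moreover have "axis_dist k x \<le> axis_dist k (f c)"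
      using mult_right_mono[of 1 c "axis_dist k x"] \<open>1 \<le> c\<close> assms(1) by (simp add: f)
    ultimately show False using ray f(1) by blast
  qed
  ultimately have sub: "f ` {1..} \<subseteq> connected_component_set (- S) x"
    by (intro connected_component_maximal)
  \<comment> \<open>The second argument pushes the axis distance to at least \<open>b + 1\<close>;
    the maximum with 1 keeps the point on the ray.\<close>
  define c where "c = max 1 ((b + 1) / axis_dist k x)"
  have "f c \<in> f ` {1..}" by (auto simp: c_def)
  then have "axis_dist k (f c) \<le> b" using sub by (intro b) blast
  moreover have "(b + 1) / axis_dist k x * axis_dist k x \<le> c * axis_dist k x"
    using assms(1) by (intro mult_right_mono) (auto simp: c_def)
  ultimately show False using assms(1) by (auto simp: f c_def)
qed

text \<open>Points outside the tube can escape. Up to height \<open>\<psi> t0\<close>, each height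
  belongs to exactly one parameter \<open>t\<close>, so beyond radius \<open>\<phi> t\<close> the
  horizontal ray is free. Above that height, a whole half-space misses the surface and the
  disk.\<close>

lemma enclosed_region_subset_tube:
  fixes k :: "'n::finite"
  assumes card: "2 \<le> CARD('n)"
    and pos: "\<And>t. t \<le> t0 \<Longrightarrow> 0 < \<phi> t"
    and cont: "continuous_on {..t0} \<psi>"
    and mono_\<psi>: "\<And>s t. s < t \<Longrightarrow> t \<le> t0 \<Longrightarrow> \<psi> s < \<psi> t"
    and unbounded: "\<And>c. \<exists>t\<le>t0. \<psi> t < c"
  shows "enclosed_region k (rotational_hypersurface k \<phi> \<psi> {..t0} \<union> horizontal_disk k (\<phi> t0) (\<psi> t0))
    \<subseteq> rotational_tube k \<phi> \<psi> {..t0}"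
    (is "enclosed_region k ?S \<subseteq> _")
proof
  fix x assume x: "x \<in> enclosed_region k ?S"
  have le: "\<psi> t \<le> \<psi> t0" if "t \<le> t0" for t
    using mono_\<psi>[of t t0] that by (cases "t = t0") auto
  show "x \<in> rotational_tube k \<phi> \<psi> {..t0}"
  proof (cases "x $ k \<le> \<psi> t0")
    case True
    obtain a where a: "a \<le> t0" "\<psi> a < x $ k" using unbounded by blast
    obtain t where t: "t \<le> t0" "\<psi> t = x $ k"
      using IVT'[of \<psi> a "x $ k" t0] a True continuous_on_subset[OF cont, of "{a..t0}"] by auto
    have "axis_dist k x \<le> \<phi> t"
    proof (rule ccontr)
      assume far: "\<not> axis_dist k x \<le> \<phi> t"
      have uniq: "s = t" if "s \<le> t0" "\<psi> s = \<psi> t" for s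
        using that t mono_\<psi>[of s t] mono_\<psi>[of t s] by (cases s t rule: linorder_cases) auto
      have "x \<notin> enclosed_region k ?S"
      proof (rule not_enclosed_if_ray)
        show "0 < axis_dist k x" using far pos[OF t(1)] by linarith
        fix y assume y: "y $ k = x $ k" "axis_dist k x \<le> axis_dist k y"
        have "y \<notin> rotational_hypersurface k \<phi> \<psi> {..t0}"
        proof
          assume "y \<in> rotational_hypersurface k \<phi> \<psi> {..t0}"
          then obtain s where s: "s \<le> t0" "axis_dist k y = \<phi> s" "y $ k = \<psi> s"
            by (auto simp: rotational_hypersurface_def)
          then have "s = t" using uniq y(1) t(2) by simp
          then show False using s y far by simp
        qed
        \<comment> \<open>The disk meets the ray's height only if \<open>t = t0\<close>, and then
          its radius is \<open>\<phi> t\<close>, which \<open>y\<close> exceeds.\<close>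
        moreover have "y \<notin> horizontal_disk k (\<phi> t0) (\<psi> t0)"
        proof
          assume "y \<in> horizontal_disk k (\<phi> t0) (\<psi> t0)"
          then have s: "axis_dist k y \<le> \<phi> t0" "y $ k = \<psi> t0" by (simp_all add: horizontal_disk_def)
          then have "t0 = t" using uniq y(1) t(2) by simp
          then show False using s y far by simp
        qed
        ultimately show "y \<notin> ?S" by simp
      qed
      then show False using x by simp
    qed
    then show ?thesis using t by (auto simp: rotational_tube_def)
  next
    case False
    let ?H = "{y. \<psi> t0 < y $ k}"
    have "convex ?H"
      using convex_halfspace_gt[of "\<psi> t0" "axis k 1 :: real^'n"] by (simp add: inner_axis inner_commute)
    then have "?H \<subseteq> connected_component_set (- ?S) x"
      using False le by (intro connected_component_maximal convex_connected)
        (auto simp: rotational_hypersurface_def horizontal_disk_def not_le[symmetric])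
    moreover have "\<not> bounded (axis_dist k ` ?H)"
    proof
      assume "bounded (axis_dist k ` ?H)"
      then obtain b where b: "\<And>y. y \<in> ?H \<Longrightarrow> axis_dist k y \<le> b"
        unfolding bounded_iff by (auto simp: axis_dist_def)
      obtain i where i: "i \<noteq> k"
        using card by (metis (full_types) UNIV_I card_le_Suc0_iff_eq finite_class.finite_UNIV not_less_eq_eq numeral_2_eq_2)
      \<comment> \<open>This point lies in the half-space, and its coordinate \<open>i\<close> alone
        already exceeds \<open>b\<close>.\<close>
      let ?y = "\<chi> l. if l = k then \<psi> t0 + 1 else \<bar>b\<bar> + 1"
      have "axis_dist k ?y \<le> b" by (rule b) simp
      then show False using norm_component_le_axis_dist[OF i, of ?y] i by auto
    qed
    ultimately have "\<not> bounded (axis_dist k ` connected_component_set (- ?S) x)"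
      by (metis bounded_subset image_mono)
    then show ?thesis using x by (simp add: enclosed_region_def)
  qed
qed

subsection \<open>The profile curve\<close>

text \<open>The derivative at \<open>t0\<close> is one-sided; restricting to \<open>{s..t}\<close>
  makes the mean value theorem available up to \<open>t0\<close>.\<close>

lemma MVT_atMost:
  fixes f f' :: "real \<Rightarrow> real"
  assumes "\<And>t. t \<le> t0 \<Longrightarrow> (f has_real_derivative f' t) (at t within {..t0})"
    and "s < t" "t \<le> t0"
  shows "\<exists>x\<in>{s<..<t}. f t - f s = f' x * (t - s)"
proof -
  have "(f has_derivative (*) (f' x)) (at x within {s..t})" if "s \<le> x" "x \<le> t" for x
    using has_field_derivative_subset[OF assms(1)[of x], of "{s..t}"] that assms(3)
    by (auto simp: has_field_derivative_def)
  from mvt_simple[OF assms(2) this] show ?thesis .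
qed

section \<open>Decay of the radius\<close>

text \<open>Bernoulli's inequality is applied with the integer exponent \<open>m\<close>; halving
  the exponent of a base in \<open>{0..1}\<close> only increases the power. The base 0 is treated
  apart because \<open>powr_realpow\<close> needs a positive one.\<close>

lemma one_minus_powr_half_le:
  fixes u :: real
  assumes "0 \<le> u" "u \<le> 1" "1 \<le> m"
  shows "1 - (1 - u) powr (real m / 2) \<le> m * u"
proof (cases "u = 1")
  case False
  have "1 - m * u \<le> (1 - u) ^ m" using Bernoulli_inequality[of "- u" m] assms by simp
  also have "\<dots> = (1 - u) powr m" using assms False by (simp add: powr_realpow)
  also have "\<dots> \<le> (1 - u) powr (real m / 2)" using assms by (intro powr_mono') auto
  finally show ?thesis by simp
qed (use assms in simp)

lemma summable_radius_power:
  fixes \<phi> \<phi>' :: "real \<Rightarrow> real"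
  assumes deriv: "\<And>t. t \<le> t0 \<Longrightarrow> (\<phi> has_real_derivative \<phi>' t) (at t within {..t0})"
    and pos: "\<And>t. t \<le> t0 \<Longrightarrow> 0 < \<phi> t" and pos': "\<And>t. t \<le> t0 \<Longrightarrow> 0 < \<phi>' t"
    and mono: "\<And>s t. s \<le> t \<Longrightarrow> t \<le> t0 \<Longrightarrow> \<phi> s \<le> \<phi> t"
    and "0 < a" and growth: "\<And>t. t \<le> t0 \<Longrightarrow> a * \<phi> t ^ Suc m \<le> (\<phi>' t)\<^sup>2"
  shows "summable (\<lambda>j. \<phi> (t0 - real j) ^ m)"
proof -
  \<comment> \<open>Half of \<open>Suc m\<close>: the root of the growth bound is
    \<open>sqrt a * \<phi> t powr q\<close>, and \<open>(q - 1) + q = m\<close> makes the derivative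
    of \<open>G\<close> dominate \<open>c * \<phi> t ^ m\<close>.\<close>
  define q where "q = (real m + 1) / 2"
  define c where "c = q * sqrt a"
  define G where "G = (\<lambda>t. \<phi> t powr q)"
  have "0 < q" by (simp add: q_def)
  have "0 < c" using \<open>0 < a\<close> \<open>0 < q\<close> by (simp add: c_def)
  have dG: "(G has_real_derivative q * \<phi> t powr (q - 1) * \<phi>' t) (at t within {..t0})" if "t \<le> t0" for t
    unfolding G_def using has_real_derivative_powr[of "\<phi> t" q] pos[OF that] deriv[OF that]
    by (auto intro!: DERIV_chain2[of "\<lambda>x. x powr q"])
  have lower: "c * \<phi> t ^ m \<le> q * \<phi> t powr (q - 1) * \<phi>' t" if "t \<le> t0" for t
  proof -
    have "sqrt a * \<phi> t powr q = sqrt (a * \<phi> t ^ Suc m)"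
      using pos[OF that] by (simp add: q_def real_sqrt_mult powr_half_sqrt[symmetric] powr_powr powr_realpow[symmetric]
          powr_add add_divide_distrib powr_mult)
    also have "\<dots> \<le> \<phi>' t"
      using growth[OF that] pos'[OF that] by (intro real_le_lsqrt) auto
    finally have "q * \<phi> t powr (q - 1) * (sqrt a * \<phi> t powr q) \<le> q * \<phi> t powr (q - 1) * \<phi>' t"
      using \<open>0 < q\<close> by (intro mult_left_mono) auto
    moreover have "\<phi> t powr (q - 1) * \<phi> t powr q = \<phi> t ^ m"
      using pos[OF that] by (simp add: powr_add[symmetric] q_def powr_realpow field_simps)
    ultimately show ?thesis by (simp add: c_def mult_ac)
  qed
  have step: "c * \<phi> (t0 - real (Suc j)) ^ m \<le> G (t0 - real j) - G (t0 - real (Suc j))" for j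
  proof -
    obtain x where x: "t0 - real (Suc j) < x" "x < t0 - real j"
      and G: "G (t0 - real j) - G (t0 - real (Suc j)) = q * \<phi> x powr (q - 1) * \<phi>' x * 1"
      using MVT_atMost[OF dG, of "t0 - real (Suc j)" "t0 - real j"] by auto
    have "\<phi> (t0 - real (Suc j)) ^ m \<le> \<phi> x ^ m"
      using x pos[of "t0 - real (Suc j)"] by (intro power_mono mono) auto
    then have "c * \<phi> (t0 - real (Suc j)) ^ m \<le> c * \<phi> x ^ m" using \<open>0 < c\<close> by simp
    then show ?thesis using lower[of x] x G by simp
  qed
  have "summable (\<lambda>j. \<phi> (t0 - real (Suc j)) ^ m)"
  proof (rule summableI_nonneg_bounded)
    fix N
    have "c * (\<Sum>j<N. \<phi> (t0 - real (Suc j)) ^ m) \<le> (\<Sum>j<N. G (t0 - real j) - G (t0 - real (Suc j)))"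
      unfolding sum_distrib_left by (intro sum_mono step)
    also have "\<dots> = G t0 - G (t0 - real N)"
      using sum_lessThan_telescope'[of "\<lambda>j. G (t0 - real j)" N] by simp
    also have "\<dots> \<le> G t0" by (simp add: G_def)
    finally show "(\<Sum>j<N. \<phi> (t0 - real (Suc j)) ^ m) \<le> G t0 / c"
      using \<open>0 < c\<close> by (simp add: field_simps)
    show "0 \<le> \<phi> (t0 - real (Suc N)) ^ m" using pos[of "t0 - real (Suc N)"] by simp
  qed
  then show ?thesis by (subst (asm) summable_Suc_iff)
qed

theorem theorem3p11:
  fixes k :: "'n::finite"
    and n :: nat
    and K t0 :: real
    and \<phi> \<phi>' \<phi>'' \<psi> \<psi>' :: "real \<Rightarrow> real"
    and M :: "(real ^ 'n) set"
  assumes "n = CARD('n)" and "n \<ge> 3" and "K < 0"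
    and "\<And>t. t \<le> t0 \<Longrightarrow> (\<phi> has_real_derivative \<phi>' t) (at t within {..t0})"
    and "\<And>t. t < t0 \<Longrightarrow> (\<phi>' has_real_derivative \<phi>'' t) (at t)"
    and "\<And>t. t \<le> t0 \<Longrightarrow> (\<psi> has_real_derivative \<psi>' t) (at t within {..t0})"
    and "\<And>t. t \<le> t0 \<Longrightarrow> (\<phi>' t)\<^sup>2 + (\<psi>' t)\<^sup>2 = 1"
    and "\<And>t. t \<le> t0 \<Longrightarrow> \<psi>' t \<ge> 0"
    and "\<And>t. t \<le> t0 \<Longrightarrow> \<phi> t > 0"
    and "\<And>t. t \<le> t0 \<Longrightarrow> \<phi>' t > 0"
    and "\<And>t. t < t0 \<Longrightarrow>
           K * \<phi> t ^ (n - 2) = - \<phi>'' t * (1 - (\<phi>' t)\<^sup>2) powr ((real n - 3) / 2)"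
    and "\<And>t. t \<le> t0 \<Longrightarrow>
           K * \<phi> t ^ (n - 1) = (1 - (\<phi>' t)\<^sup>2) powr ((real n - 1) / 2) + (- 1)"
    and "\<And>t. t \<le> t0 \<Longrightarrow> \<phi> t \<le> \<phi> t0"
    and "\<phi> t0 = (- 1 / K) powr (1 / (real n - 1))"
    and "M = rotational_hypersurface k \<phi> \<psi> {..t0}"
  shows "hausdorff_measure (n - 1) M < \<infinity> \<and>
         enclosed_region k (M \<union> horizontal_disk k (\<phi> t0) (\<psi> t0)) \<in> lmeasurable"
proof -
  note n = assms(1,2) and d\<phi> = assms(4) and d\<psi> = assms(6) and arclength = assms(7)
    and \<psi>'_nonneg = assms(8) and pos = assms(9) and pos' = assms(10) and first_integral = assms(12)
    and M = assms(15)
  have card: "2 \<le> CARD('n)" using n by simp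
  have \<phi>'_le: "\<bar>\<phi>' t\<bar> \<le> 1" and \<psi>'_le: "\<bar>\<psi>' t\<bar> \<le> 1" if "t \<le> t0" for t
    using arclength[OF that] zero_le_power2[of "\<phi>' t"] zero_le_power2[of "\<psi>' t"]
    unfolding abs_square_le_1[symmetric] by linarith+
  have lip_\<phi>: "\<bar>\<phi> s - \<phi> t\<bar> \<le> \<bar>s - t\<bar>" if "s \<le> t0" "t \<le> t0" for s t
    using field_differentiable_bound[of "{..t0}" \<phi> \<phi>' 1 s t] d\<phi> \<phi>'_le that by auto
  have lip_\<psi>: "\<bar>\<psi> s - \<psi> t\<bar> \<le> \<bar>s - t\<bar>" if "s \<le> t0" "t \<le> t0" for s t
    using field_differentiable_bound[of "{..t0}" \<psi> \<psi>' 1 s t] d\<psi> \<psi>'_le that by auto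
  have cont: "continuous_on {..t0} \<phi>" "continuous_on {..t0} \<psi>"
    using d\<phi> d\<psi> by (auto intro!: DERIV_continuous_on)
  have strict_mono_\<phi>: "\<phi> s < \<phi> t" if st: "s < t" "t \<le> t0" for s t
  proof -
    obtain x where "x \<in> {s<..<t}" "\<phi> t - \<phi> s = \<phi>' x * (t - s)" using MVT_atMost[OF d\<phi> st] by blast
    then show ?thesis using pos'[of x] st by (smt (verit) greaterThanLessThan_iff mult_pos_pos)
  qed
  have mono_\<phi>: "\<phi> s \<le> \<phi> t" if "s \<le> t" "t \<le> t0" for s t
    using strict_mono_\<phi>[of s t] that by (cases "s = t") auto
  \<comment> \<open>The first integral makes the left side the power \<open>n - 1\<close> of
    \<open>\<psi>'\<close>. As \<open>\<psi>'\<close> lies in \<open>{0..1}\<close> and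
    \<open>n \<ge> 3\<close>, this is at most its square, hence at most
    \<open>\<psi>'\<close>.\<close>
  have \<psi>'_ge: "1 + K * \<phi> t ^ (n - 1) \<le> \<psi>' t" if "t \<le> t0" for t
  proof -
    have "1 - (\<phi>' t)\<^sup>2 = (\<psi>' t)\<^sup>2" using arclength[OF that] by simp
    then have "1 + K * \<phi> t ^ (n - 1) = (\<psi>' t)\<^sup>2 powr ((real n - 1) / 2)"
      using first_integral[OF that] by simp
    also have "\<dots> \<le> (\<psi>' t)\<^sup>2 powr 1"
      using n \<psi>'_le[OF that] by (intro powr_mono') (auto simp: abs_square_le_1)
    also have "\<dots> = \<psi>' t * \<psi>' t" by (simp add: power2_eq_square)
    also have "\<dots> \<le> \<psi>' t" using \<psi>'_nonneg[OF that] \<psi>'_le[OF that] by (intro mult_left_le) auto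
    finally show ?thesis .
  qed
  \<comment> \<open>At \<open>t0\<close> the first integral gives only nonnegativity; strict growth
    of \<open>\<phi>\<close> and \<open>K < 0\<close> make it strict earlier.\<close>
  have lower_pos: "0 < 1 + K * \<phi> t ^ (n - 1)" if "t < t0" for t
  proof -
    have "\<phi> t ^ (n - 1) < \<phi> t0 ^ (n - 1)"
      using strict_mono_\<phi>[of t t0] pos[of t] that n by (intro power_strict_mono) auto
    then have "K * \<phi> t0 ^ (n - 1) < K * \<phi> t ^ (n - 1)" using \<open>K < 0\<close> by simp
    moreover have "0 \<le> 1 + K * \<phi> t0 ^ (n - 1)" using first_integral[of t0] by simp
    ultimately show ?thesis by linarith
  qed
  have strict_mono_\<psi>: "\<psi> s < \<psi> t" if st: "s < t" "t \<le> t0" for s t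
  proof -
    obtain x where x: "x \<in> {s<..<t}" "\<psi> t - \<psi> s = \<psi>' x * (t - s)" using MVT_atMost[OF d\<psi> st] by blast
    then have "0 < \<psi>' x" using \<psi>'_ge[of x] lower_pos[of x] st by auto
    then show ?thesis using x st by (smt (verit) mult_pos_pos)
  qed
  have mono_\<psi>: "\<psi> s \<le> \<psi> t" if "s \<le> t" "t \<le> t0" for s t
    using strict_mono_\<psi>[of s t] that by (cases "s = t") auto
  have unbounded: "\<exists>t\<le>t0. \<psi> t < c" for c
  proof -
    \<comment> \<open>This is a positive lower bound for \<open>\<psi>'\<close> left of
      \<open>t0 - 1\<close>, so \<open>\<psi>\<close> falls at least linearly there. The distance
      from \<open>t\<close> to \<open>t0 - 1\<close> is chosen to force a drop of at least
      \<open>w + \<bar>\<psi> (t0 - 1) - c\<bar>\<close>.\<close>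
    define w where "w = 1 + K * \<phi> (t0 - 1) ^ (n - 1)"
    have w: "0 < w" using lower_pos[of "t0 - 1"] by (simp add: w_def)
    define t where "t = t0 - 2 - \<bar>\<psi> (t0 - 1) - c\<bar> / w"
    have t: "t < t0 - 1" using w by (simp add: t_def) (smt (verit) divide_nonneg_pos)
    obtain x where x: "x \<in> {t<..<t0 - 1}" "\<psi> (t0 - 1) - \<psi> t = \<psi>' x * (t0 - 1 - t)"
      using MVT_atMost[OF d\<psi> t] by auto
    have "\<phi> x ^ (n - 1) \<le> \<phi> (t0 - 1) ^ (n - 1)" using x pos[of x] by (intro power_mono mono_\<phi>) auto
    then have "w \<le> \<psi>' x" using \<psi>'_ge[of x] x \<open>K < 0\<close> by (auto simp: w_def intro: order_trans[rotated])
    then have "w * (t0 - 1 - t) \<le> \<psi> (t0 - 1) - \<psi> t" unfolding x(2) using t by (intro mult_right_mono) auto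
    moreover have "w * (t0 - 1 - t) = w + \<bar>\<psi> (t0 - 1) - c\<bar>" using w by (simp add: t_def field_simps)
    ultimately have "\<psi> t < c" using w by linarith
    then show ?thesis using t by (intro exI[of _ t]) auto
  qed
  have sum: "summable (\<lambda>j. \<phi> (t0 - real j) ^ (CARD('n) - 2))"
  \<comment> \<open>The constant \<open>a\<close> comes from the Bernoulli bound with
    \<open>m = n - 1\<close>, after division by \<open>n - 1\<close>.\<close>
  proof (rule summable_radius_power[OF d\<phi> pos pos' mono_\<phi>, where a = "- K / (real n - 1)"])
    show "0 < - K / (real n - 1)" using \<open>K < 0\<close> n(2) by (simp add: divide_neg_pos)
    fix t assume t: "t \<le> t0"
    have "- K * \<phi> t ^ (n - 1) = 1 - (1 - (\<phi>' t)\<^sup>2) powr (real (n - 1) / 2)"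
      using first_integral[OF t] n(2) by (simp add: of_nat_diff)
    also have "\<dots> \<le> real (n - 1) * (\<phi>' t)\<^sup>2"
      using \<phi>'_le[OF t] n(2) by (intro one_minus_powr_half_le) (auto simp: abs_square_le_1)
    finally have "- K * \<phi> t ^ (n - 1) \<le> (real n - 1) * (\<phi>' t)\<^sup>2" using n(2) by (simp add: of_nat_diff)
    moreover have "Suc (CARD('n) - 2) = n - 1" using n by simp
    ultimately show "- K / (real n - 1) * \<phi> t ^ Suc (CARD('n) - 2) \<le> (\<phi>' t)\<^sup>2"
      using n(2) by (simp add: field_simps)
  qed auto
  have "hausdorff_measure (n - 1) M < \<infinity>"
    unfolding M n(1) by (rule hausdorff_measure_rotational_hypersurface_finite[OF card pos mono_\<phi> lip_\<phi> lip_\<psi> sum])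
  moreover have "enclosed_region k (M \<union> horizontal_disk k (\<phi> t0) (\<psi> t0)) \<in> lmeasurable" (is "?E \<in> _")
  proof -
    have "open ?E"
      unfolding M by (intro open_enclosed_region closed_Un closed_horizontal_disk
          closed_rotational_hypersurface[OF cont mono_\<psi> unbounded])
    then have "?E \<in> sets lborel" by simp
    obtain B where B: "B \<in> sets lborel" "rotational_tube k \<phi> \<psi> {..t0} \<subseteq> B" "emeasure lborel B < \<infinity>"
      using rotational_tube_finite_volume[OF card pos mono_\<phi> mono_\<psi> lip_\<psi> sum] by blast
    have "?E \<subseteq> B"
      using enclosed_region_subset_tube[where \<phi> = \<phi>, OF card pos cont(2) strict_mono_\<psi> unbounded] B(2) unfolding M by blast
    then have "emeasure lborel ?E \<le> emeasure lborel B" using B(1) by (rule emeasure_mono)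
    then have "emeasure lborel ?E < \<infinity>" using B(3) by (rule le_less_trans)
    then show ?thesis
      using \<open>?E \<in> sets lborel\<close> by (intro fmeasurableI) (auto simp: emeasure_completion)
  qed
  ultimately show ?thesis by blast
qed

end
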